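(* There exists a curve $\gamma=(\gamma_1,\gamma_2,\gamma_3):[-1,1]\to\mathbb{R}^{3}$ in $C^\infty([-1,1])$ such that all leading principal minors of the $3\times3$ matrix with columns $(\gamma'(t),\gamma''(t),\gamma'''(t))$ are positive for all $t\in[-1,1]$, except that the $2\times2$ and $3\times3$ leading principal minors vanish at $t=0$, and such that the map $B^{\sup}$ defined by $$B^{\sup}\big(\lambda\overline{\gamma}(x)+(1-\lambda)\overline{\gamma}(1)\big)=\lambda\gamma_3(x)+(1-\lambda)\gamma_3(1),\qquad \lambda\in[0,1],\ x\in[-1,1],$$ is not concave on $\mathrm{conv}(\overline{\gamma}([-1,1]))$.
   Context: $\overline{\gamma}=(\gamma_1,\gamma_2)$ denotes the projection of $\gamma$ onto the first two coordinates, and $\mathrm{conv}$ denotes convex hull. *)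

theory Defs
  imports "HOL-Analysis.Analysis"
begin

(* Derivatives are taken within the set S, hence one-sided at the endpoints of an interval. *)
primrec nth_vderiv :: "real set \<Rightarrow> nat \<Rightarrow> (real \<Rightarrow> 'a::real_normed_vector) \<Rightarrow> real \<Rightarrow> 'a" where
  "nth_vderiv S 0 f = f"
| "nth_vderiv S (Suc n) f = (\<lambda>t. vector_derivative (nth_vderiv S n f) (at t within S))"

definition smooth_curve_on :: "real set \<Rightarrow> (real \<Rightarrow> 'a::real_normed_vector) \<Rightarrow> bool" where
  "smooth_curve_on S f \<longleftrightarrow> (\<forall>n. nth_vderiv S n f differentiable_on S)"

(* In A $ i $ j the index i is the row, so the columns are the first three derivatives. *)
definition deriv_matrix :: "(real \<Rightarrow> real^3) \<Rightarrow> real \<Rightarrow> real^3^3" where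
  "deriv_matrix \<gamma> t = transpose (vector
     [nth_vderiv {-1..1} 1 \<gamma> t, nth_vderiv {-1..1} 2 \<gamma> t, nth_vderiv {-1..1} 3 \<gamma> t])"

definition lead_minor1 :: "real^3^3 \<Rightarrow> real" where
  "lead_minor1 A = A $ 1 $ 1"

definition lead_minor2 :: "real^3^3 \<Rightarrow> real" where
  "lead_minor2 A =
     det (vector [vector [A $ 1 $ 1, A $ 1 $ 2], vector [A $ 2 $ 1, A $ 2 $ 2]] :: real^2^2)"

definition lead_minor3 :: "real^3^3 \<Rightarrow> real" where
  "lead_minor3 A = det A"

definition proj12 :: "(real \<Rightarrow> real^3) \<Rightarrow> real \<Rightarrow> real^2" where
  "proj12 \<gamma> t = vector [\<gamma> t $ 1, \<gamma> t $ 2]"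

(* The first conjunct says that the chords issuing from the right endpoint fill the convex
   hull, so that the formula determines B on all of it; consistency of the formula at
   points with several representations is what makes such a B exist. *)
definition is_Bsup :: "(real \<Rightarrow> real^3) \<Rightarrow> (real^2 \<Rightarrow> real) \<Rightarrow> bool" where
  "is_Bsup \<gamma> B \<longleftrightarrow>
     convex hull (proj12 \<gamma> ` {-1..1}) =
       {l *\<^sub>R proj12 \<gamma> x + (1 - l) *\<^sub>R proj12 \<gamma> 1 | l x. l \<in> {0..1} \<and> x \<in> {-1..1}} \<and>
     (\<forall>l\<in>{0..1}. \<forall>x\<in>{-1..1}.
       B (l *\<^sub>R proj12 \<gamma> x + (1 - l) *\<^sub>R proj12 \<gamma> 1) = l * \<gamma> x $ 3 + (1 - l) * \<gamma> 1 $ 3)"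

end

theory Submission
  imports Defs "HOL-Computational_Algebra.Polynomial"
begin

text \<open>
  The witness is \<open>\<gamma>(t) = (t, t\<^sup>4, -t\<^sup>3)\<close>. When \<open>\<gamma>\<^sub>1(t) = t\<close>, the two larger minors are
  \<open>\<gamma>\<^sub>2''\<close> and, where it does not vanish, \<open>(\<gamma>\<^sub>2'')\<^sup>2 (\<gamma>\<^sub>3'' / \<gamma>\<^sub>2'')'\<close>, so positivity of the minors
  makes \<open>\<gamma>\<^sub>3'' / \<gamma>\<^sub>2''\<close> increase there. A zero of \<open>\<gamma>\<^sub>2''\<close> at the origin lets this
  quotient drop: here it equals \<open>-1 / (2 t)\<close>, which increases on both sides of the origin and falls
  from \<open>\<infinity>\<close> to \<open>-\<infinity>\<close> across it. The minors are \<open>1\<close>, \<open>12 t\<^sup>2\<close> and \<open>72 t\<^sup>2\<close>.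

  Write \<open>chord_slope x = (1 - x\<^sup>4) / (1 - x) = 1 + x + x\<^sup>2 + x\<^sup>3\<close> for the slope of the chord from \<open>(x, x\<^sup>4)\<close>
  to \<open>(1, 1)\<close>. Since it is strictly increasing (\<open>chord_slope_inj\<close>), the chords meet only in
  \<open>(1, 1)\<close>, so the formula for \<open>B\<close> is consistent (\<open>chord_height_unique\<close>); since the slope is continuous,
  the chords fill the convex hull, which is the region \<open>a\<^sup>4 \<le> b \<le> 1\<close>
  (\<open>convex_hull_quartic_eq_chords\<close>).

  Measured from the common endpoint, \<open>B\<close> is homogeneous of degree one, and its values are
  controlled by \<open>1 + x + x\<^sup>2 = (1 - x\<^sup>3) / (1 - x)\<close> as a function of \<open>chord_slope x\<close>. The derivative of that
  function is \<open>(1 + 2 x) / (1 + 2 x + 3 x\<^sup>2)\<close>, whose derivative in \<open>x\<close> has the sign of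
  \<open>-x (1 + x)\<close>. Hence \<open>B\<close> is strictly convex across the chords with \<open>-1 < x < 0\<close>. Concretely, on
  the segment from \<open>(0, 0)\<close> to \<open>(0, 1)\<close> it vanishes at both ends and equals \<open>-1/4\<close> at \<open>(0, 3/8)\<close>.
\<close>

section \<open>Derivatives of polynomial curves\<close>

definition poly_curve :: "real poly ^ 'n \<Rightarrow> real \<Rightarrow> real ^ 'n" where
  "poly_curve P t = (\<chi> i. poly (P $ i) t)"

lemma poly_curve_has_vector_derivative:
  "(poly_curve P has_vector_derivative poly_curve (\<chi> i. pderiv (P $ i)) t) (at t within S)"
proof -
  have "((\<lambda>t. poly_curve P t $ i) has_vector_derivative poly_curve (\<chi> i. pderiv (P $ i)) t $ i)
          (at t within S)" for i
    using has_field_derivative_at_within[OF poly_DERIV, of "P $ i" t S]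
    by (simp add: poly_curve_def has_real_derivative_iff_has_vector_derivative)
  moreover have "((\<lambda>t. \<chi> i. poly_curve P t $ i) has_vector_derivative 
      (\<chi> i. poly_curve (\<chi> i. pderiv (P $ i)) t $ i)) (at t within S)"
    if "\<And>i. ((\<lambda>t. poly_curve P t $ i) has_vector_derivative
           poly_curve (\<chi> i. pderiv (P $ i)) t $ i) (at t within S)"
    using that unfolding has_vector_derivative_def
    by (subst has_derivative_componentwise_within)
       (auto simp: Basis_vec_def inner_axis)
  ultimately show ?thesis
    by simp
qed

text \<open>
  The iterated derivatives are only controlled on the interval, because a derivative within a set is
  determined by its defining property only at limit points of that set.
\<close>
lemma nth_vderiv_poly_curve:
  fixes a b :: real
  assumes "a < b" "t \<in> {a..b}"
  shows "nth_vderiv {a..b} n (poly_curve P) t = poly_curve (\<chi> i. (pderiv ^^ n) (P $ i)) t"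
  using assms(2)
proof (induction n arbitrary: t)
  case 0
  then show ?case by simp
next
  case (Suc n)
  have "(poly_curve (\<chi> i. (pderiv ^^ n) (P $ i)) has_vector_derivative
          poly_curve (\<chi> i. (pderiv ^^ Suc n) (P $ i)) t) (at t within {a..b})"
    using poly_curve_has_vector_derivative[of "\<chi> i. (pderiv ^^ n) (P $ i)"] by simp
  then have "(nth_vderiv {a..b} n (poly_curve P) has_vector_derivative
          poly_curve (\<chi> i. (pderiv ^^ Suc n) (P $ i)) t) (at t within {a..b})"
    by (rule has_vector_derivative_transform[rotated 2]) (use Suc in auto)
  then show ?case
    using assms(1) Suc.prems by (simp add: vector_derivative_within_closed_interval)
qed

lemma smooth_curve_on_poly_curve:
  fixes a b :: real
  assumes "a < b"
  shows "smooth_curve_on {a..b} (poly_curve P)"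
  unfolding smooth_curve_on_def
proof
  fix n
  have "poly_curve (\<chi> i. (pderiv ^^ n) (P $ i)) differentiable_on {a..b}"
    unfolding differentiable_on_def
    by (metis poly_curve_has_vector_derivative has_vector_derivative_def differentiable_def)
  then show "nth_vderiv {a..b} n (poly_curve P) differentiable_on {a..b}"
    unfolding differentiable_on_def
    by (metis differentiable_transform_within nth_vderiv_poly_curve[OF assms] zero_less_one)
qed

section \<open>The curve and its minors\<close>

definition quartic_coords :: "real poly ^ 3" where
  "quartic_coords = vector [monom 1 1, monom 1 4, monom (- 1) 3]"

abbreviation quartic :: "real \<Rightarrow> real ^ 3" where
  "quartic \<equiv> poly_curve quartic_coords"

lemma quartic_component [simp]:
  "quartic t $ 1 = t" "quartic t $ 2 = t ^ 4" "quartic t $ 3 = - (t ^ 3)"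
  by (simp_all add: poly_curve_def quartic_coords_def poly_monom)

lemma deriv_matrix_quartic:
  assumes "t \<in> {-1..1}"
  shows "deriv_matrix quartic t = vector
    [vector [1, 0, 0], vector [4 * t ^ 3, 12 * t\<^sup>2, 24 * t], vector [- 3 * t\<^sup>2, - 6 * t, - 6]]"
  using assms
  by (simp add: deriv_matrix_def nth_vderiv_poly_curve transpose_def vec_eq_iff forall_3
      poly_curve_def quartic_coords_def pderiv_monom poly_monom numeral_2_eq_2 numeral_3_eq_3
      del: nth_vderiv.simps)

lemma lead_minors_quartic:
  assumes "t \<in> {-1..1}"
  shows "lead_minor1 (deriv_matrix quartic t) = 1"
    and "lead_minor2 (deriv_matrix quartic t) = 12 * t\<^sup>2"
    and "lead_minor3 (deriv_matrix quartic t) = 72 * t\<^sup>2"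
  using assms
  by (simp_all add: deriv_matrix_quartic lead_minor1_def lead_minor2_def lead_minor3_def
      det_2 det_3 power2_eq_square)

section \<open>The chords from the right endpoint\<close>

lemma proj12_quartic_component [simp]:
  "proj12 quartic t $ 1 = t" "proj12 quartic t $ 2 = t ^ 4"
  by (simp_all add: proj12_def)

abbreviation chord_point :: "real \<Rightarrow> real \<Rightarrow> real ^ 2" where
  "chord_point l x \<equiv> l *\<^sub>R proj12 quartic x + (1 - l) *\<^sub>R proj12 quartic 1"

definition chord_slope :: "real \<Rightarrow> real" where
  "chord_slope x = 1 + x + x\<^sup>2 + x ^ 3"

lemma chord_slope_mult: "(1 - x) * chord_slope x = 1 - x ^ 4"
  by (simp add: chord_slope_def algebra_simps power2_eq_square power3_eq_cube power4_eq_xxxx)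

text \<open>
  The difference quotient of the slope is half of a sum of squares, one of which is \<open>1\<close>,
  and so it is positive.
\<close>
lemma chord_slope_inj:
  assumes "chord_slope x = chord_slope y"
  shows "x = y"
proof -
  have "(x - y) * ((x + y + 1)\<^sup>2 + x\<^sup>2 + y\<^sup>2 + 1) = 2 * (chord_slope x - chord_slope y)"
    by (simp add: chord_slope_def algebra_simps power2_eq_square power3_eq_cube)
  moreover have "(x + y + 1)\<^sup>2 + x\<^sup>2 + y\<^sup>2 + 1 > 0"
    by (intro add_nonneg_pos add_nonneg_nonneg) auto
  ultimately show ?thesis
    using assms by auto
qed

text \<open>
  Away from the common endpoint, the quotient of the two coordinate equations gives equal slopes,
  hence the same chord and the same parameter on it; at the common endpoint all heights are \<open>-1\<close>.
\<close>
lemma chord_height_unique: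
  assumes "chord_point l x = chord_point m y"
  shows "l * quartic x $ 3 + (1 - l) * quartic 1 $ 3 = m * quartic y $ 3 + (1 - m) * quartic 1 $ 3"
proof -
  have "chord_point l x $ 1 = chord_point m y $ 1" "chord_point l x $ 2 = chord_point m y $ 2"
    using assms by simp_all
  then have fst_eq: "l * (1 - x) = m * (1 - y)" and snd_eq: "l * (1 - x ^ 4) = m * (1 - y ^ 4)"
    by (simp_all add: algebra_simps)
  have "l * (1 - x ^ 3) = m * (1 - y ^ 3)"
  proof (cases "l * (1 - x) = 0")
    case True
    then have "m * (1 - y) = 0"
      using fst_eq by simp
    with True have "l = 0 \<or> x = 1" "m = 0 \<or> y = 1"
      by simp_all
    then show ?thesis
      by auto
  next
    case False
    have "l * (1 - x) * chord_slope x = m * (1 - y) * chord_slope y"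
      using snd_eq by (simp add: mult.assoc chord_slope_mult)
    then have "x = y"
      using False unfolding fst_eq by (simp add: chord_slope_inj)
    moreover from this have "l = m"
      using False fst_eq by simp
    ultimately show ?thesis
      by simp
  qed
  then show ?thesis
    by (simp add: algebra_simps)
qed

lemma convex_quartic_region: "convex {p :: real ^ 2. (p $ 1) ^ 4 \<le> p $ 2 \<and> p $ 2 \<le> 1}"
proof (rule convexI)
  fix p r :: "real ^ 2" and u v :: real
  assume "p \<in> {p. (p $ 1) ^ 4 \<le> p $ 2 \<and> p $ 2 \<le> 1}" "r \<in> {p. (p $ 1) ^ 4 \<le> p $ 2 \<and> p $ 2 \<le> 1}"
    and uv: "0 \<le> u" "0 \<le> v" "u + v = 1"
  then have pr: "(p $ 1) ^ 4 \<le> p $ 2" "p $ 2 \<le> 1" "(r $ 1) ^ 4 \<le> r $ 2" "r $ 2 \<le> 1"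
    by auto
  have "(u * p $ 1 + v * r $ 1) ^ 4 \<le> u * (p $ 1) ^ 4 + v * (r $ 1) ^ 4"
    using convex_power_even[of 4] uv by (simp add: convex_on_def)
  also have "\<dots> \<le> u * p $ 2 + v * r $ 2"
    using pr uv by (intro add_mono mult_left_mono) auto
  finally show "u *\<^sub>R p + v *\<^sub>R r \<in> {p. (p $ 1) ^ 4 \<le> p $ 2 \<and> p $ 2 \<le> 1}"
    using convex_bound_le[OF pr(2,4) uv] by simp
qed

text \<open>
  The chord through \<open>(a, b)\<close> has slope \<open>s = (1 - b) / (1 - a)\<close>, and \<open>a\<^sup>4 \<le> b \<le> 1\<close> places \<open>s\<close> between
  the slopes \<open>0\<close> and \<open>chord_slope a\<close> of the chords from \<open>-1\<close> and from \<open>a\<close>. The intermediate value theorem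
  yields a chord of slope \<open>s\<close> that starts at some \<open>x \<le> a\<close>, so that \<open>(a, b)\<close> lies on it.
\<close>
lemma quartic_region_chord:
  fixes p :: "real ^ 2"
  assumes "(p $ 1) ^ 4 \<le> p $ 2" "p $ 2 \<le> 1"
  shows "\<exists>l\<in>{0..1}. \<exists>x\<in>{-1..1}. p = chord_point l x"
proof -
  define a b where "a = p $ 1" and "b = p $ 2"
  have ab: "a ^ 4 \<le> b" "b \<le> 1"
    using assms by (simp_all add: a_def b_def)
  then have "\<bar>a\<bar> ^ 4 \<le> 1"
    by simp
  then have a: "-1 \<le> a" "a \<le> 1"
    using power_le_one_iff[of "\<bar>a\<bar>" 4] by auto
  show ?thesis
  proof (cases "a = 1")
    case True
    then have "p = chord_point 1 1"
      using ab by (simp add: vec_eq_iff forall_2 a_def b_def)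
    then show ?thesis
      by (intro bexI[of _ 1]) auto
  next
    case False
    then have "a < 1"
      using a by simp
    define s where "s = (1 - b) / (1 - a)"
    have "0 \<le> s"
      using ab \<open>a < 1\<close> by (simp add: s_def)
    moreover have "s \<le> chord_slope a"
      using ab \<open>a < 1\<close> chord_slope_mult[of a] by (simp add: s_def divide_le_eq mult.commute)
    moreover have "chord_slope (-1) = 0"
      by (simp add: chord_slope_def)
    moreover have "continuous_on {-1..a} chord_slope"
      unfolding chord_slope_def by (intro continuous_intros)
    ultimately obtain x where x: "-1 \<le> x" "x \<le> a" "chord_slope x = s"
      using IVT'[of chord_slope "-1" s a] a by auto
    define l where "l = (1 - a) / (1 - x)"
    have l: "l * (1 - x) = 1 - a" "l \<in> {0..1}"
      using x \<open>a < 1\<close> by (auto simp: l_def divide_simps)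
    have "l * (1 - x ^ 4) = (l * (1 - x)) * chord_slope x"
      by (simp add: mult.assoc chord_slope_mult)
    also have "\<dots> = 1 - b"
      using x(3) \<open>a < 1\<close> by (simp add: l(1) s_def)
    finally have "p = chord_point l x"
      using l(1) by (simp add: vec_eq_iff forall_2 a_def b_def algebra_simps)
    then show ?thesis
      using x(1,2) \<open>a < 1\<close> l(2) by (intro bexI[of _ l] bexI[of _ x]) auto
  qed
qed

lemma convex_hull_quartic_eq_chords:
  "convex hull (proj12 quartic ` {-1..1}) =
     {chord_point l x | l x. l \<in> {0..1} \<and> x \<in> {-1..1}}" (is "?H = ?C")
proof
  have "?H \<subseteq> {p. (p $ 1) ^ 4 \<le> p $ 2 \<and> p $ 2 \<le> 1}"
  proof (intro hull_minimal convex_quartic_region image_subsetI)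
    fix x :: real
    assume "x \<in> {-1..1}"
    then have "\<bar>x\<bar> ^ 4 \<le> 1"
      by (intro power_le_one) auto
    then show "proj12 quartic x \<in> {p. (p $ 1) ^ 4 \<le> p $ 2 \<and> p $ 2 \<le> 1}"
      by simp
  qed
  then show "?H \<subseteq> ?C"
    using quartic_region_chord by blast
next
  have "chord_point l x \<in> ?H" if "l \<in> {0..1}" "x \<in> {-1..1}" for l x
    using that by (intro convexD[OF convex_convex_hull] hull_inc) auto
  then show "?C \<subseteq> ?H"
    by blast
qed

lemma ex_is_Bsup_quartic: "\<exists>B. is_Bsup quartic B"
proof -
  define B where "B p = (SOME v. \<exists>l x. p = chord_point l x \<and>
    v = l * quartic x $ 3 + (1 - l) * quartic 1 $ 3)" for p
  have "B (chord_point l x) = l * quartic x $ 3 + (1 - l) * quartic 1 $ 3" for l x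
    unfolding B_def
    by (rule some_equality) (blast, metis chord_height_unique)
  then show ?thesis
    unfolding is_Bsup_def using convex_hull_quartic_eq_chords by blast
qed

section \<open>Failure of concavity\<close>

text \<open>
  The points \<open>(0, 0)\<close>, \<open>(0, 3/8)\<close> and \<open>(0, 1)\<close> lie on the chords from \<open>0\<close>, \<open>-1/2\<close> and \<open>-1\<close>: the two
  ends and an interior point of the range of chords across which \<open>B\<close> is strictly convex.
\<close>
lemma not_concave_Bsup_quartic:
  assumes "is_Bsup quartic B"
  shows "\<not> concave_on (convex hull (proj12 quartic ` {-1..1})) B"
proof
  let ?H = "convex hull (proj12 quartic ` {-1..1})"
  assume "concave_on ?H B"
  have height: "B (chord_point l x) = - l * x ^ 3 - (1 - l)"
    if "l \<in> {0..1}" "x \<in> {-1..1}" for l x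
    using assms that by (simp add: is_Bsup_def)
  have in_hull: "chord_point l x \<in> ?H" if "l \<in> {0..1}" "x \<in> {-1..1}" for l x
    unfolding convex_hull_quartic_eq_chords mem_Collect_eq
    using that by (intro exI[of _ l] exI[of _ x] conjI) (rule refl)
  have "chord_point 1 0 \<in> ?H" "chord_point (1/2) (-1) \<in> ?H"
    by (rule in_hull; simp)+
  with \<open>concave_on ?H B\<close> have "(1 - 3/8) * B (chord_point 1 0) + 3/8 * B (chord_point (1/2) (-1)) \<le>
      B ((1 - 3/8) *\<^sub>R chord_point 1 0 + (3/8) *\<^sub>R chord_point (1/2) (-1))"
    by (intro concave_onD[where f = B]) simp_all
  also have "(1 - 3/8) *\<^sub>R chord_point 1 0 + (3/8) *\<^sub>R chord_point (1/2) (-1) =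
      chord_point (2/3) (-1/2)"
    by (simp add: vec_eq_iff forall_2 power_divide)
  finally have "(1 - 3/8) * B (chord_point 1 0) + 3/8 * B (chord_point (1/2) (-1)) \<le>
      B (chord_point (2/3) (-1/2))" .
  moreover have "B (chord_point 1 0) = 0" "B (chord_point (1/2) (-1)) = 0"
    "B (chord_point (2/3) (-1/2)) = - 1/4"
    by (subst height; simp add: power_divide)+
  ultimately have "(1 - 3/8) * 0 + 3/8 * 0 \<le> (- 1/4 :: real)"
    by (simp only:)
  then show False
    by simp
qed

theorem proposition2p2:
  "\<exists>\<gamma> :: real \<Rightarrow> real^3.
     smooth_curve_on {-1..1} \<gamma> \<and>
     (\<forall>t\<in>{-1..1}. lead_minor1 (deriv_matrix \<gamma> t) > 0) \<and>
     (\<forall>t\<in>{-1..1} - {0}. lead_minor2 (deriv_matrix \<gamma> t) > 0 \<and> lead_minor3 (deriv_matrix \<gamma> t) > 0) \<and>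
     lead_minor2 (deriv_matrix \<gamma> 0) = 0 \<and> lead_minor3 (deriv_matrix \<gamma> 0) = 0 \<and>
     (\<exists>B. is_Bsup \<gamma> B \<and> \<not> concave_on (convex hull (proj12 \<gamma> ` {-1..1})) B)"
proof (intro exI[of _ quartic] conjI)
  show "smooth_curve_on {-1..1} quartic"
    by (rule smooth_curve_on_poly_curve) simp
  show "\<exists>B. is_Bsup quartic B \<and> \<not> concave_on (convex hull (proj12 quartic ` {-1..1})) B"
    using ex_is_Bsup_quartic not_concave_Bsup_quartic by blast
qed (simp_all add: lead_minors_quartic)

end
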